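(* There exists a multipointed $d$-space which is not cofibrant in any of the three model structures on $\mathcal{G}\mathbf{dTop}$: the q-model structure, the h-model structure and the m-model structure.
   Context: $\mathbf{Top}$ is the category of $\Delta$-generated spaces, i.e. topological spaces that are colimits of standard topological simplices; it is cartesian closed with internal hom $\mathbf{TOP}(-,-)$. The kelleyfication is the right adjoint of the inclusion of $\mathbf{Top}$ into all topological spaces (it does not change underlying sets). A q-fibration of $\mathbf{Top}$ is a map with the right lifting property with respect to the inclusions $\mathbf{D}^n\times\{0\}\subset \mathbf{D}^n\times[0,1]$, $n\ge 0$. An h-fibration is a map with the right lifting property with respect to $Z\times\{0\}\subset Z\times[0,1]$ for all spaces $Z$ of $\mathbf{Top}$. $\mathcal{G}$ is the topological group of nondecreasing homeomorphisms $[0,1]\to[0,1]$. For continuous $\gamma_1,\gamma_2:[0,1]\to U$ with $\gamma_1(1)=\gamma_2(0)$, the normalized composition $\gamma_1 *_N\gamma_2:[0,1]\to U$ is $\gamma_1(2t)$ for $t\le 1/2$ and $\gamma_2(2t-1)$ for $t\geq 1/2$. A multipointed $d$-space $X$ is a triple $(|X|,X^0,\mathbb{P}^{\mathcal{G}}X)$ where $|X|$ is a space of $\mathbf{Top}$, $X^0\subset |X|$ is a subset (the states), and $\mathbb{P}^{\mathcal{G}}X$ is a set of continuous maps $[0,1]\to|X|$ (the execution paths) such that: $\gamma(0),\gamma(1)\in X^0$ for every execution path $\gamma$; $\gamma.\phi$ is an execution path for every execution path $\gamma$ and every $\phi\in\mathcal{G}$; $\gamma_1*_N\gamma_2$ is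 an execution path for all composable execution paths $\gamma_1,\gamma_2$. A map $f:X\to Y$ is a continuous map $|X|\to|Y|$ taking $X^0$ to $Y^0$ (inducing $f^0:X^0\to Y^0$) such that $f.\gamma\in\mathbb{P}^{\mathcal{G}}Y$ for all $\gamma\in\mathbb{P}^{\mathcal{G}}X$. The category is $\mathcal{G}\mathbf{dTop}$. $\mathbb{P}^{\mathcal{G}}_{\alpha,\beta}X$ is the set of execution paths from $\alpha$ to $\beta$, equipped with the kelleyfication of the relative topology from $\mathbf{TOP}([0,1],|X|)$. The q-, h- and m-model structures on $\mathcal{G}\mathbf{dTop}$ are the unique model structures such that $f:X\to Y$ is a weak equivalence iff $f^0$ is a bijection and each $\mathbb{P}^{\mathcal{G}}_{\alpha,\beta}X\to \mathbb{P}^{\mathcal{G}}_{f(\alpha),f(\beta)}Y$ belongs to $\mathcal{W}$, and a fibration iff each such map belongs to $\mathcal{F}$, where: for q, $\mathcal{W}$ = weak homotopy equivalences and $\mathcal{F}$ = q-fibrations; for h, $\mathcal{W}$ = homotopy equivalences and $\mathcal{F}$ = h-fibrations; for m, $\mathcal{W}$ = weak homotopy equivalences and $\mathcal{F}$ = h-fibrations. These model structures exist. *)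

theory Defs
  imports "HOL-Analysis.Analysis" "HOL-Homology.Simplices"
begin

section \<open>\<open>\<Delta>\<close>-generated spaces\<close>

abbreviation unit_interval :: "real topology" where
  "unit_interval \<equiv> top_of_set {0..1}"

definition simplex_space :: "nat \<Rightarrow> (nat \<Rightarrow> real) topology" where
  "simplex_space n = subtopology (powertop_real UNIV) (standard_simplex n)"

text \<open>
  A diagram of simplices has a set \<open>I\<close> of vertices, the space \<open>simplex_space (d i)\<close> at vertex \<open>i\<close>,
  and a set \<open>M\<close> of arrows \<open>(i, j, \<phi>)\<close> labelled by continuous maps. Composites and identities need
  not be listed in \<open>M\<close>: they do not affect the colimit.
\<close>

type_synonym 'i simplex_arrow = "'i \<times> 'i \<times> ((nat \<Rightarrow> real) \<Rightarrow> (nat \<Rightarrow> real))"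

definition simplex_diagram :: "'i set \<Rightarrow> ('i \<Rightarrow> nat) \<Rightarrow> 'i simplex_arrow set \<Rightarrow> bool" where
  "simplex_diagram I d M \<longleftrightarrow>
     (\<forall>(i, j, \<phi>)\<in>M. i \<in> I \<and> j \<in> I \<and>
        continuous_map (simplex_space (d i)) (simplex_space (d j)) \<phi>)"

definition simplex_glue ::
  "('i \<Rightarrow> nat) \<Rightarrow> 'i simplex_arrow set \<Rightarrow> (('i \<times> (nat \<Rightarrow> real)) \<times> ('i \<times> (nat \<Rightarrow> real))) set" where
  "simplex_glue d M =
     {((i, s), (j, \<phi> s)) |i j \<phi> s. (i, j, \<phi>) \<in> M \<and> s \<in> topspace (simplex_space (d i))}"

text \<open>The cocone \<open>c\<close> exhibits \<open>X\<close> as the quotient of the disjoint sum of the simplices by the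
  equivalence relation generated by the arrows, that is, as the colimit of the diagram.\<close>

definition is_simplex_colimit ::
  "'i set \<Rightarrow> ('i \<Rightarrow> nat) \<Rightarrow> 'i simplex_arrow set \<Rightarrow> 'a topology \<Rightarrow> ('i \<Rightarrow> (nat \<Rightarrow> real) \<Rightarrow> 'a) \<Rightarrow> bool"
  where
  "is_simplex_colimit I d M X c \<longleftrightarrow>
     (\<Union>i\<in>I. c i ` topspace (simplex_space (d i))) = topspace X \<and>
     (\<forall>i\<in>I. \<forall>j\<in>I. \<forall>s\<in>topspace (simplex_space (d i)). \<forall>t\<in>topspace (simplex_space (d j)).
        c i s = c j t \<longleftrightarrow> ((i, s), (j, t)) \<in> (simplex_glue d M \<union> (simplex_glue d M)\<inverse>)\<^sup>*) \<and>
     (\<forall>U. openin X U \<longleftrightarrow> U \<subseteq> topspace X \<and>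
        (\<forall>i\<in>I. openin (simplex_space (d i)) {s \<in> topspace (simplex_space (d i)). c i s \<in> U}))"

text \<open>The index type is large enough for all singular simplices of \<open>X\<close>, so fixing it is no
  restriction: see \<open>delta_generated_if_colimit\<close> below.\<close>

definition delta_generated :: "'a topology \<Rightarrow> bool" where
  "delta_generated X \<longleftrightarrow>
     (\<exists>(I :: (nat \<times> ((nat \<Rightarrow> real) \<Rightarrow> 'a)) set) d M c.
        simplex_diagram I d M \<and> is_simplex_colimit I d M X c)"

definition kelley_open :: "'a topology \<Rightarrow> 'a set \<Rightarrow> bool" where
  "kelley_open X U \<longleftrightarrow> U \<subseteq> topspace X \<and>
     (\<forall>n \<sigma>. continuous_map (simplex_space n) X \<sigma> \<longrightarrow>
        openin (simplex_space n) {s \<in> topspace (simplex_space n). \<sigma> s \<in> U})"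

text \<open>The lemmas \<open>delta_generated_kelley\<close> and \<open>continuous_map_into_kelley_iff\<close> below state that
  \<open>kelley\<close> is the right adjoint of the inclusion of \<open>\<Delta>\<close>-generated spaces into topological
  spaces.\<close>

definition kelley :: "'a topology \<Rightarrow> 'a topology" where
  "kelley X = topology (kelley_open X)"

lemma istopology_kelley_open: "istopology (kelley_open X)"
  unfolding istopology_def
proof (intro conjI allI impI)
  fix S T assume S: "kelley_open X S" and T: "kelley_open X T"
  have eq: "{s \<in> topspace (simplex_space n). \<sigma> s \<in> S \<inter> T} =
      {s \<in> topspace (simplex_space n). \<sigma> s \<in> S} \<inter> {s \<in> topspace (simplex_space n). \<sigma> s \<in> T}" for n \<sigma>
    by auto
  show "kelley_open X (S \<inter> T)"
    using S T unfolding kelley_open_def eq by auto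
next
  fix \<K> assume K: "\<forall>K\<in>\<K>. kelley_open X K"
  have eq: "{s \<in> topspace (simplex_space n). \<sigma> s \<in> \<Union>\<K>} =
      (\<Union>K\<in>\<K>. {s \<in> topspace (simplex_space n). \<sigma> s \<in> K})" for n \<sigma>
    by auto
  show "kelley_open X (\<Union>\<K>)"
    using K unfolding kelley_open_def eq by blast
qed

lemma openin_kelley: "openin (kelley X) U \<longleftrightarrow> kelley_open X U"
  by (simp add: kelley_def istopology_kelley_open)

lemma kelley_open_if_openin: "openin X U \<Longrightarrow> kelley_open X U"
  by (auto simp: kelley_open_def openin_subset openin_continuous_map_preimage)

lemma topspace_kelley [simp]: "topspace (kelley X) = topspace X"
proof -
  have "kelley_open X (topspace X)"
    by (simp add: kelley_open_if_openin)
  then show ?thesis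
    by (metis kelley_open_def openin_kelley openin_subset openin_topspace subset_antisym)
qed

lemma continuous_map_simplex_kelley:
  "continuous_map (simplex_space n) (kelley X) \<sigma> \<longleftrightarrow> continuous_map (simplex_space n) X \<sigma>"
  by (auto simp: continuous_map_def openin_kelley kelley_open_if_openin)
    (auto simp: kelley_open_def continuous_map_def)

lemma delta_generated_if_colimit:
  assumes "is_simplex_colimit I d M X c"
  shows "kelley X = X"
proof -
  have cont: "continuous_map (simplex_space (d i)) X (c i)" if "i \<in> I" for i
    using assms that unfolding is_simplex_colimit_def continuous_map_def by auto
  have final: "openin X U \<longleftrightarrow> U \<subseteq> topspace X \<and>
      (\<forall>i\<in>I. openin (simplex_space (d i)) {s \<in> topspace (simplex_space (d i)). c i s \<in> U})" for U
    using assms unfolding is_simplex_colimit_def by simp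
  have "openin X U" if "kelley_open X U" for U
    unfolding final using that cont by (simp add: kelley_open_def)
  then have "openin X U \<longleftrightarrow> kelley_open X U" for U
    using kelley_open_if_openin by (rule iffI[rotated])
  then show ?thesis
    by (simp add: topology_eq openin_kelley)
qed

lemma delta_generated_kelley: "delta_generated (kelley X)"
proof -
  define I :: "(nat \<times> ((nat \<Rightarrow> real) \<Rightarrow> 'a)) set"
    where "I = {(n, \<sigma>). continuous_map (simplex_space n) X \<sigma>}"
  define M :: "(nat \<times> ((nat \<Rightarrow> real) \<Rightarrow> 'a)) simplex_arrow set"
    where "M = {(i, j, \<phi>). i \<in> I \<and> j \<in> I \<and>
      continuous_map (simplex_space (fst i)) (simplex_space (fst j)) \<phi> \<and>
      (\<forall>s\<in>topspace (simplex_space (fst i)). snd j (\<phi> s) = snd i s)}"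
  define G where "G = simplex_glue fst M"
  define e :: "nat \<Rightarrow> real" where "e = (\<lambda>j. if j = 0 then 1 else 0)"
  have top0: "topspace (simplex_space 0) = {e}"
    by (simp add: simplex_space_def standard_simplex_0 e_def)
  have vertex: "(((0, \<lambda>_. x), e), ((n, \<sigma>), s)) \<in> G \<and> (0, \<lambda>_. x) \<in> I"
    if "(n, \<sigma>) \<in> I" "s \<in> topspace (simplex_space n)" "\<sigma> s = x" for n \<sigma> s x
  proof -
    have "x \<in> topspace X"
      using that by (auto simp: I_def continuous_map_def)
    then have "((0, \<lambda>_. x), (n, \<sigma>), (\<lambda>_. s)) \<in> M" "(0, \<lambda>_. x) \<in> I"
      using that by (auto simp: M_def I_def)
    then show ?thesis
      using top0 by (auto simp: G_def simplex_glue_def)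
  qed
  have G_eq: "snd i s = snd j t" if "((i, s), (j, t)) \<in> G" for i s j t
    using that by (auto simp: G_def simplex_glue_def M_def)
  have star_eq: "snd (fst a) (snd a) = snd (fst b) (snd b)" if "(a, b) \<in> (G \<union> G\<inverse>)\<^sup>*" for a b
    using that
  proof (induction rule: rtrancl_induct)
    case (step y z)
    then show ?case
      using G_eq[of "fst y" "snd y" "fst z" "snd z"] G_eq[of "fst z" "snd z" "fst y" "snd y"] by auto
  qed simp
  have glue: "(a, b) \<in> (G \<union> G\<inverse>)\<^sup>*"
    if a: "fst a \<in> I" "snd a \<in> topspace (simplex_space (fst (fst a)))"
      and b: "fst b \<in> I" "snd b \<in> topspace (simplex_space (fst (fst b)))"
      and eq: "snd (fst a) (snd a) = snd (fst b) (snd b)" for a b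
  proof -
    define x where "x = snd (fst a) (snd a)"
    have "(((0, \<lambda>_. x), e), a) \<in> G" "(((0, \<lambda>_. x), e), b) \<in> G"
      using vertex[of "fst (fst a)" "snd (fst a)" "snd a" x]
        vertex[of "fst (fst b)" "snd (fst b)" "snd b" x] a b eq by (auto simp: x_def)
    then have "(a, ((0, \<lambda>_. x), e)) \<in> G \<union> G\<inverse>" "(((0, \<lambda>_. x), e), b) \<in> G \<union> G\<inverse>"
      by auto
    then show ?thesis
      by (meson rtrancl.simps r_into_rtrancl)
  qed
  have cover: "(\<Union>i\<in>I. snd i ` topspace (simplex_space (fst i))) = topspace (kelley X)"
  proof
    show "(\<Union>i\<in>I. snd i ` topspace (simplex_space (fst i))) \<subseteq> topspace (kelley X)"
      by (auto simp: I_def continuous_map_def)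
    show "topspace (kelley X) \<subseteq> (\<Union>i\<in>I. snd i ` topspace (simplex_space (fst i)))"
    proof
      fix x assume "x \<in> topspace (kelley X)"
      then have "(0, \<lambda>_. x) \<in> I"
        by (simp add: I_def)
      then show "x \<in> (\<Union>i\<in>I. snd i ` topspace (simplex_space (fst i)))"
        using top0 by force
    qed
  qed
  have "is_simplex_colimit I fst M (kelley X) snd"
    unfolding is_simplex_colimit_def G_def[symmetric]
  proof (intro conjI ballI allI cover)
    fix i j s t
    assume "i \<in> I" "j \<in> I" "s \<in> topspace (simplex_space (fst i))" "t \<in> topspace (simplex_space (fst j))"
    then show "snd i s = snd j t \<longleftrightarrow> ((i, s), j, t) \<in> (G \<union> G\<inverse>)\<^sup>*"
      using glue[of "(i, s)" "(j, t)"] star_eq[of "(i, s)" "(j, t)"] by auto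
  next
    fix U
    show "openin (kelley X) U \<longleftrightarrow> U \<subseteq> topspace (kelley X) \<and>
        (\<forall>i\<in>I. openin (simplex_space (fst i)) {s \<in> topspace (simplex_space (fst i)). snd i s \<in> U})"
      by (auto simp: openin_kelley kelley_open_def I_def)
  qed
  moreover have "simplex_diagram I fst M"
    by (auto simp: simplex_diagram_def M_def)
  ultimately show ?thesis
    unfolding delta_generated_def by blast
qed

lemma delta_generated_iff: "delta_generated X \<longleftrightarrow> kelley X = X"
  using delta_generated_if_colimit delta_generated_kelley unfolding delta_generated_def by metis

lemma continuous_map_into_kelley_iff:
  assumes "delta_generated Z"
  shows "continuous_map Z (kelley X) f \<longleftrightarrow> continuous_map Z X f"
proof
  assume "continuous_map Z (kelley X) f"
  then show "continuous_map Z X f"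
    by (auto simp: continuous_map_def openin_kelley kelley_open_if_openin)
next
  assume f: "continuous_map Z X f"
  have "openin Z {z \<in> topspace Z. f z \<in> U}" if U: "kelley_open X U" for U
  proof -
    have "kelley_open Z {z \<in> topspace Z. f z \<in> U}"
      unfolding kelley_open_def
    proof (intro conjI allI impI)
      fix n \<sigma> assume \<sigma>: "continuous_map (simplex_space n) Z \<sigma>"
      have "continuous_map (simplex_space n) X (f \<circ> \<sigma>)"
        using \<sigma> f by (rule continuous_map_compose)
      then have "openin (simplex_space n) {s \<in> topspace (simplex_space n). (f \<circ> \<sigma>) s \<in> U}"
        using U unfolding kelley_open_def by blast
      moreover have "{s \<in> topspace (simplex_space n). (f \<circ> \<sigma>) s \<in> U} =
          {s \<in> topspace (simplex_space n). \<sigma> s \<in> {z \<in> topspace Z. f z \<in> U}}"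
        using continuous_map_funspace[OF \<sigma>] by auto
      ultimately show "openin (simplex_space n)
          {s \<in> topspace (simplex_space n). \<sigma> s \<in> {z \<in> topspace Z. f z \<in> U}}"
        by simp
    qed auto
    then show ?thesis
      using assms by (metis delta_generated_iff openin_kelley)
  qed
  then show "continuous_map Z (kelley X) f"
    using f by (auto simp: continuous_map_def openin_kelley)
qed


section \<open>Spaces of paths\<close>

text \<open>Maps defined on \<open>[0,1]\<close> are represented by functions that are \<^const>\<open>extensional\<close> on \<open>{0..1}\<close>.\<close>

definition paths_in :: "'a topology \<Rightarrow> (real \<Rightarrow> 'a) set" where
  "paths_in X = {\<gamma> \<in> extensional {0..1}. continuous_map unit_interval X \<gamma>}"

definition compact_open_paths :: "'a topology \<Rightarrow> (real \<Rightarrow> 'a) topology" where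
  "compact_open_paths X = topology_generated_by
     {{\<gamma> \<in> paths_in X. \<gamma> ` K \<subseteq> U} |K U. compactin unit_interval K \<and> openin X U}"

text \<open>The internal hom \<open>TOP([0,1], X)\<close>; its universal property is \<open>path_space_exponential\<close>. The
  product of a \<open>\<Delta>\<close>-generated space with the locally compact space \<open>[0,1]\<close> is \<open>\<Delta>\<close>-generated, so
  that \<^const>\<open>prod_topology\<close> is the right product there, and in all notions of homotopy below.\<close>

definition path_space :: "'a topology \<Rightarrow> (real \<Rightarrow> 'a) topology" where
  "path_space X = kelley (compact_open_paths X)"

lemma topspace_compact_open_paths [simp]: "topspace (compact_open_paths X) = paths_in X"
proof -
  have "{\<gamma> \<in> paths_in X. \<gamma> ` {} \<subseteq> {}} \<in>
      {{\<gamma> \<in> paths_in X. \<gamma> ` K \<subseteq> U} |K U. compactin unit_interval K \<and> openin X U}"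
    by (intro CollectI exI[of _ "{}"]) auto
  then show ?thesis
    unfolding compact_open_paths_def topology_generated_by_topspace by auto
qed

lemma path_space_exponential:
  assumes "delta_generated Z"
  shows "continuous_map Z (path_space X) F \<longleftrightarrow>
    F ` topspace Z \<subseteq> extensional {0..1} \<and>
    continuous_map (prod_topology Z unit_interval) X (\<lambda>(z, t). F z t)"
    (is "_ \<longleftrightarrow> ?R")
proof -
  define B where "B = {{\<gamma> \<in> paths_in X. \<gamma> ` K \<subseteq> U} |K U. compactin unit_interval K \<and> openin X U}"
  have co: "compact_open_paths X = topology_generated_by B"
    by (simp add: compact_open_paths_def B_def)
  have UB: "\<Union>B = paths_in X"
    using topspace_compact_open_paths[of X] by (simp add: co topology_generated_by_topspace)
  have "continuous_map Z (path_space X) F \<longleftrightarrow> continuous_map Z (compact_open_paths X) F"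
    by (simp add: path_space_def continuous_map_into_kelley_iff assms)
  also have "\<dots> \<longleftrightarrow> ?R"
  proof
    assume F: "continuous_map Z (compact_open_paths X) F"
    then have Fp: "F z \<in> paths_in X" if "z \<in> topspace Z" for z
      using that by (metis continuous_map_funspace PiE topspace_compact_open_paths)
    have sub: "F ` topspace Z \<subseteq> extensional {0..1}"
      using Fp by (auto simp: paths_in_def)
    have "openin (prod_topology Z unit_interval)
        {p \<in> topspace (prod_topology Z unit_interval). (case p of (z, t) \<Rightarrow> F z t) \<in> U}"
      (is "openin _ ?W") if U: "openin X U" for U
    proof (subst openin_subopen, intro ballI)
      fix p assume "p \<in> ?W"
      then obtain z t where p: "p = (z, t)" "z \<in> topspace Z" "t \<in> {0..1}" "F z t \<in> U"
        by auto
      have "openin unit_interval {s \<in> topspace unit_interval. F z s \<in> U}"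
        using Fp[OF p(2)] U openin_continuous_map_preimage by (fastforce simp: paths_in_def)
      then obtain \<delta> where \<delta>: "\<delta> > 0" "\<And>s. s \<in> {0..1} \<Longrightarrow> dist s t < \<delta> \<Longrightarrow> F z s \<in> U"
        using p unfolding openin_euclidean_subtopology_iff by auto
      define K where "K = cball t (\<delta>/2) \<inter> {0..1}"
      define V where "V = ball t (\<delta>/2) \<inter> {0..1}"
      have K: "compactin unit_interval K"
        unfolding K_def by (simp add: compactin_subtopology compact_Int_closed compact_cball)
      have V: "openin unit_interval V" "t \<in> V" "V \<subseteq> K"
        using \<delta>(1) p(3) by (auto simp: V_def K_def openin_open)
      let ?A = "{\<gamma> \<in> paths_in X. \<gamma> ` K \<subseteq> U}"
      have "openin (compact_open_paths X) ?A"
        unfolding co by (rule topology_generated_by_Basis) (use K U B_def in blast)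
      then have O: "openin Z {y \<in> topspace Z. F y \<in> ?A}"
        using F by (rule openin_continuous_map_preimage[rotated])
      have "F z ` K \<subseteq> U"
      proof (rule image_subsetI)
        fix s assume "s \<in> K"
        then have "s \<in> {0..1}" "dist s t < \<delta>"
          using \<delta>(1) by (auto simp: K_def dist_commute)
        then show "F z s \<in> U"
          by (rule \<delta>(2))
      qed
      then have "p \<in> {y \<in> topspace Z. F y \<in> ?A} \<times> V"
        using p V Fp by auto
      moreover have "{y \<in> topspace Z. F y \<in> ?A} \<times> V \<subseteq> ?W"
        using V by (auto simp: V_def)
      moreover have "openin (prod_topology Z unit_interval) ({y \<in> topspace Z. F y \<in> ?A} \<times> V)"
        using O V(1) unfolding openin_prod_Times_iff by (intro disjI2 conjI)
      ultimately show "\<exists>T. openin (prod_topology Z unit_interval) T \<and> p \<in> T \<and> T \<subseteq> ?W"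
        by (intro exI conjI)
    qed
    moreover have "(case p of (z, t) \<Rightarrow> F z t) \<in> topspace X"
      if "p \<in> topspace (prod_topology Z unit_interval)" for p
      using that Fp by (fastforce simp: paths_in_def continuous_map_def)
    ultimately have "continuous_map (prod_topology Z unit_interval) X (\<lambda>(z, t). F z t)"
      unfolding continuous_map_def by blast
    with sub show ?R
      by (rule conjI)
  next
    assume R: ?R
    have slice: "continuous_map unit_interval X (F z)" if "z \<in> topspace Z" for z
    proof -
      have "continuous_map unit_interval (prod_topology Z unit_interval) (\<lambda>t. (z, t))"
        using that by (auto simp: continuous_map_paired)
      from continuous_map_compose[OF this, of X "\<lambda>(z, t). F z t"] R show ?thesis
        by (simp add: o_def)
    qed
    have Fp: "F ` topspace Z \<subseteq> paths_in X"
      using R slice by (auto simp: paths_in_def)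
    have "openin Z (F -` A \<inter> topspace Z)" if "A \<in> B" for A
    proof -
      obtain K U where A: "A = {\<gamma> \<in> paths_in X. \<gamma> ` K \<subseteq> U}"
        and K: "compactin unit_interval K" and U: "openin X U"
        using \<open>A \<in> B\<close> B_def by blast
      have K01: "K \<subseteq> {0..1}"
        using compactin_subset_topspace[OF K] by simp
      let ?W = "{p \<in> topspace (prod_topology Z unit_interval). (case p of (z, t) \<Rightarrow> F z t) \<in> U}"
      have W: "openin (prod_topology Z unit_interval) ?W"
        using R U by (blast intro: openin_continuous_map_preimage)
      show ?thesis
      proof (subst openin_subopen, intro ballI)
        fix z assume z: "z \<in> F -` A \<inter> topspace Z"
        then have "{z} \<times> K \<subseteq> ?W"
          using K01 A by auto
        then obtain P V where PV: "openin Z P" "openin unit_interval V" "z \<in> P" "K \<subseteq> V" "P \<times> V \<subseteq> ?W"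
          using tube_lemma_right[OF W K, of z] z by auto
        have "P \<subseteq> F -` A \<inter> topspace Z"
          using PV Fp openin_subset[OF PV(1)] by (force simp: A)
        with PV(1,3) show "\<exists>T. openin Z T \<and> z \<in> T \<and> T \<subseteq> F -` A \<inter> topspace Z"
          by (intro exI conjI)
      qed
    qed
    then show "continuous_map Z (compact_open_paths X) F"
      using Fp UB unfolding co continuous_on_generated_topo_iff by simp
  qed
  finally show ?thesis .
qed


section \<open>Fibrations and weak equivalences of spaces\<close>

text \<open>Right lifting property of \<open>p\<close> with respect to \<open>Z \<times> {0} \<subseteq> Z \<times> [0,1]\<close>.\<close>

definition homotopy_lifting ::
  "'z topology \<Rightarrow> 'a topology \<Rightarrow> 'b topology \<Rightarrow> ('a \<Rightarrow> 'b) \<Rightarrow> bool" where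
  "homotopy_lifting Z E B p \<longleftrightarrow>
     (\<forall>u v. continuous_map (prod_topology Z (top_of_set {0::real})) E u \<longrightarrow>
        continuous_map (prod_topology Z unit_interval) B v \<longrightarrow>
        (\<forall>z\<in>topspace Z. p (u (z, 0)) = v (z, 0)) \<longrightarrow>
        (\<exists>h. continuous_map (prod_topology Z unit_interval) E h \<and>
           (\<forall>z\<in>topspace Z. h (z, 0) = u (z, 0)) \<and>
           (\<forall>z\<in>topspace Z. \<forall>t\<in>{0..1}. p (h (z, t)) = v (z, t))))"

definition disk :: "nat \<Rightarrow> (nat \<Rightarrow> real) topology" where
  "disk n = subtopology (Euclidean_space n) {x. (\<Sum>i<n. (x i)\<^sup>2) \<le> 1}"

definition q_fibration :: "'a topology \<Rightarrow> 'b topology \<Rightarrow> ('a \<Rightarrow> 'b) \<Rightarrow> bool" where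
  "q_fibration E B p \<longleftrightarrow> continuous_map E B p \<and> (\<forall>n. homotopy_lifting (disk n) E B p)"

text \<open>HOL cannot quantify over spaces of all types inside a definition. The type chosen for \<open>Z\<close>
  contains the mapping path space of \<open>p\<close>, and so nothing is lost: see \<open>h_fibration_lifting\<close>.\<close>

definition h_fibration :: "'a topology \<Rightarrow> 'b topology \<Rightarrow> ('a \<Rightarrow> 'b) \<Rightarrow> bool" where
  "h_fibration E B p \<longleftrightarrow> continuous_map E B p \<and>
     (\<forall>Z :: ('a \<times> (real \<Rightarrow> 'b)) topology. delta_generated Z \<longrightarrow> homotopy_lifting Z E B p)"

lemma h_fibration_lifting:
  fixes Z :: "'z topology"
  assumes p: "h_fibration E B p" and Z: "delta_generated Z"
  shows "homotopy_lifting Z E B p"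
  unfolding homotopy_lifting_def
proof (intro allI impI)
  fix u v
  assume u: "continuous_map (prod_topology Z (top_of_set {0::real})) E u"
    and v: "continuous_map (prod_topology Z unit_interval) B v"
    and uv: "\<forall>z\<in>topspace Z. p (u (z, 0)) = v (z, 0)"
  define N0 where "N0 = subtopology (prod_topology E (path_space B)) {(e, \<omega>). p e = \<omega> 0}"
  define N where "N = kelley N0"
  have N: "delta_generated N"
    unfolding N_def by (rule delta_generated_kelley)
  have "continuous_map N N0 (\<lambda>x. x)"
    using continuous_map_into_kelley_iff[OF N, of N0 "\<lambda>x. x"] by (simp add: N_def)
  then have id: "continuous_map N (prod_topology E (path_space B)) (\<lambda>x. x)"
    unfolding N0_def by (rule continuous_map_into_fulltopology)
  have fst: "continuous_map N E fst" and snd: "continuous_map N (path_space B) snd"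
    using continuous_map_compose[OF id continuous_map_fst]
      continuous_map_compose[OF id continuous_map_snd] by (simp_all add: o_def)
  have tN: "p (fst y) = snd y 0" if "y \<in> topspace N" for y
    using that by (auto simp: N_def N0_def)
  have u': "continuous_map (prod_topology N (top_of_set {0::real})) E (fst \<circ> fst)"
    using continuous_map_compose[OF continuous_map_fst fst] .
  have v': "continuous_map (prod_topology N unit_interval) B (\<lambda>(y, t). snd y t)"
    using snd path_space_exponential[OF N] by blast
  have N_lift: "homotopy_lifting N E B p"
    using p N by (simp add: h_fibration_def)
  have uv': "\<forall>y\<in>topspace N. p ((fst \<circ> fst) (y, 0)) = (case (y, 0) of (y, t) \<Rightarrow> snd y t)"
    using tN by simp
  note N_lift[unfolded homotopy_lifting_def, THEN spec, THEN spec, THEN mp, OF u', THEN mp, OF v',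
      THEN mp, OF uv']
  then obtain h where h: "continuous_map (prod_topology N unit_interval) E h"
    "\<And>y. y \<in> topspace N \<Longrightarrow> h (y, 0) = fst y"
    "\<And>y t. y \<in> topspace N \<Longrightarrow> t \<in> {0..1} \<Longrightarrow> p (h (y, t)) = snd y t"
    by auto
  define k where "k = (\<lambda>z. (u (z, 0), restrict (\<lambda>t. v (z, t)) {0..1}))"
  have k1: "continuous_map Z E (\<lambda>z. u (z, 0))"
  proof -
    have "continuous_map Z (prod_topology Z (top_of_set {0::real})) (\<lambda>z. (z, 0))"
      by (auto simp: continuous_map_paired)
    from continuous_map_compose[OF this u] show ?thesis
      by (simp add: o_def)
  qed
  have k0: "continuous_map (prod_topology Z unit_interval) B (\<lambda>(z, t). restrict (\<lambda>t. v (z, t)) {0..1} t)"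
    by (rule continuous_map_eq[OF v]) auto
  have k2: "continuous_map Z (path_space B) (\<lambda>z. restrict (\<lambda>t. v (z, t)) {0..1})"
    unfolding path_space_exponential[OF Z]
    by (intro conjI image_subsetI restrict_extensional k0)
  have "continuous_map Z N0 k"
    unfolding N0_def
  proof (rule continuous_map_into_subtopology)
    show "continuous_map Z (prod_topology E (path_space B)) k"
      using k1 k2 by (simp add: k_def continuous_map_paired)
    show "k \<in> topspace Z \<rightarrow> {(e, \<omega>). p e = \<omega> 0}"
      using uv by (auto simp: k_def)
  qed
  then have k: "continuous_map Z N k"
    using continuous_map_into_kelley_iff[OF Z, of N0 k] by (simp add: N_def)
  have kN: "k z \<in> topspace N" if "z \<in> topspace Z" for z
    using continuous_map_funspace[OF k] that by (rule funcset_mem)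
  have kid: "continuous_map (prod_topology Z unit_interval) (prod_topology N unit_interval)
      (\<lambda>(z, t). (k z, t))"
    using k by (simp add: continuous_map_prod_top)
  show "\<exists>h. continuous_map (prod_topology Z unit_interval) E h \<and>
      (\<forall>z\<in>topspace Z. h (z, 0) = u (z, 0)) \<and>
      (\<forall>z\<in>topspace Z. \<forall>t\<in>{0..1}. p (h (z, t)) = v (z, t))"
  proof (intro exI conjI ballI)
    show "continuous_map (prod_topology Z unit_interval) E (h \<circ> (\<lambda>(z, t). (k z, t)))"
      using kid h(1) by (rule continuous_map_compose)
  next
    fix z assume "z \<in> topspace Z"
    then show "(h \<circ> (\<lambda>(z, t). (k z, t))) (z, 0) = u (z, 0)"
      using h(2)[OF kN] by (simp add: k_def)
  next
    fix z and t :: real assume "z \<in> topspace Z" "t \<in> {0..1}"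
    then show "p ((h \<circ> (\<lambda>(z, t). (k z, t))) (z, t)) = v (z, t)"
      using h(3)[OF kN] by (simp add: k_def)
  qed
qed

definition homotopy_equivalence :: "'a topology \<Rightarrow> 'b topology \<Rightarrow> ('a \<Rightarrow> 'b) \<Rightarrow> bool" where
  "homotopy_equivalence X Y f \<longleftrightarrow> continuous_map X Y f \<and>
     (\<exists>g. continuous_map Y X g \<and>
        homotopic_with (\<lambda>_. True) X X (g \<circ> f) id \<and>
        homotopic_with (\<lambda>_. True) Y Y (f \<circ> g) id)"

definition cube :: "nat \<Rightarrow> (nat \<Rightarrow> real) topology" where
  "cube n = product_topology (\<lambda>_. unit_interval) {..<n}"

definition cube_boundary :: "nat \<Rightarrow> (nat \<Rightarrow> real) set" where
  "cube_boundary n = {s \<in> topspace (cube n). \<exists>i<n. s i = 0 \<or> s i = 1}"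

definition spheroids :: "nat \<Rightarrow> 'a topology \<Rightarrow> 'a \<Rightarrow> ((nat \<Rightarrow> real) \<Rightarrow> 'a) set" where
  "spheroids n X x = {a. continuous_map (cube n) X a \<and> a ` cube_boundary n \<subseteq> {x}}"

definition spheroid_rel ::
  "nat \<Rightarrow> 'a topology \<Rightarrow> 'a \<Rightarrow> (((nat \<Rightarrow> real) \<Rightarrow> 'a) \<times> ((nat \<Rightarrow> real) \<Rightarrow> 'a)) set" where
  "spheroid_rel n X x = {(a, b). a \<in> spheroids n X x \<and> b \<in> spheroids n X x \<and>
     homotopic_with (\<lambda>c. c ` cube_boundary n \<subseteq> {x}) (cube n) X a b}"

text \<open>The underlying set of the \<open>n\<close>-th homotopy group. The group structure is not needed: an
  induced map is a homomorphism, hence an isomorphism as soon as it is bijective.\<close>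

definition homotopy_classes :: "nat \<Rightarrow> 'a topology \<Rightarrow> 'a \<Rightarrow> ((nat \<Rightarrow> real) \<Rightarrow> 'a) set set" where
  "homotopy_classes n X x = spheroids n X x // spheroid_rel n X x"

definition induced_on_classes ::
  "nat \<Rightarrow> 'b topology \<Rightarrow> 'a \<Rightarrow> ('a \<Rightarrow> 'b) \<Rightarrow> ((nat \<Rightarrow> real) \<Rightarrow> 'a) set \<Rightarrow> ((nat \<Rightarrow> real) \<Rightarrow> 'b) set" where
  "induced_on_classes n Y x f C = spheroid_rel n Y (f x) `` ((\<lambda>a. f \<circ> a) ` C)"

definition weak_homotopy_equivalence :: "'a topology \<Rightarrow> 'b topology \<Rightarrow> ('a \<Rightarrow> 'b) \<Rightarrow> bool" where
  "weak_homotopy_equivalence X Y f \<longleftrightarrow> continuous_map X Y f \<and>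
     bij_betw (\<lambda>C. \<Union>x\<in>C. path_component_of_set Y (f x))
       (path_components_of X) (path_components_of Y) \<and>
     (\<forall>n\<ge>1. \<forall>x\<in>topspace X. bij_betw (induced_on_classes n Y x f)
        (homotopy_classes n X x) (homotopy_classes n Y (f x)))"


section \<open>Multipointed \<open>d\<close>-spaces\<close>

definition reparam :: "(real \<Rightarrow> real) set" where
  "reparam = {\<phi>. mono_on {0..1} \<phi> \<and> homeomorphic_map unit_interval unit_interval \<phi>}"

definition norm_comp :: "(real \<Rightarrow> 'a) \<Rightarrow> (real \<Rightarrow> 'a) \<Rightarrow> real \<Rightarrow> 'a" where
  "norm_comp \<gamma>1 \<gamma>2 = restrict (\<lambda>t. if t \<le> 1/2 then \<gamma>1 (2 * t) else \<gamma>2 (2 * t - 1)) {0..1}"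

record 'a mdspace =
  carrier_space :: "'a topology"
  states :: "'a set"
  exec_paths :: "(real \<Rightarrow> 'a) set"

definition multipointed_d_space :: "'a mdspace \<Rightarrow> bool" where
  "multipointed_d_space X \<longleftrightarrow>
     delta_generated (carrier_space X) \<and>
     states X \<subseteq> topspace (carrier_space X) \<and>
     exec_paths X \<subseteq> paths_in (carrier_space X) \<and>
     (\<forall>\<gamma>\<in>exec_paths X. \<gamma> 0 \<in> states X \<and> \<gamma> 1 \<in> states X) \<and>
     (\<forall>\<gamma>\<in>exec_paths X. \<forall>\<phi>\<in>reparam. compose {0..1} \<gamma> \<phi> \<in> exec_paths X) \<and>
     (\<forall>\<gamma>1\<in>exec_paths X. \<forall>\<gamma>2\<in>exec_paths X.
        \<gamma>1 1 = \<gamma>2 0 \<longrightarrow> norm_comp \<gamma>1 \<gamma>2 \<in> exec_paths X)"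

text \<open>A morphism is given by its values on the points of the source, so that equality of morphisms
  out of \<open>X\<close> means agreement on \<open>topspace (carrier_space X)\<close>. The objects of the category are the
  multipointed \<open>d\<close>-spaces over the type \<open>'a\<close>, which plays the role of the universe.\<close>

definition md_map :: "'a mdspace \<Rightarrow> 'a mdspace \<Rightarrow> ('a \<Rightarrow> 'a) \<Rightarrow> bool" where
  "md_map X Y f \<longleftrightarrow> multipointed_d_space X \<and> multipointed_d_space Y \<and>
     continuous_map (carrier_space X) (carrier_space Y) f \<and>
     f ` states X \<subseteq> states Y \<and>
     (\<forall>\<gamma>\<in>exec_paths X. compose {0..1} f \<gamma> \<in> exec_paths Y)"

definition path_hom :: "'a mdspace \<Rightarrow> 'a \<Rightarrow> 'a \<Rightarrow> (real \<Rightarrow> 'a) topology" where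
  "path_hom X \<alpha> \<beta> = kelley (subtopology (path_space (carrier_space X))
     {\<gamma> \<in> exec_paths X. \<gamma> 0 = \<alpha> \<and> \<gamma> 1 = \<beta>})"

type_synonym 'a space_map_class =
  "(real \<Rightarrow> 'a) topology \<Rightarrow> (real \<Rightarrow> 'a) topology \<Rightarrow> ((real \<Rightarrow> 'a) \<Rightarrow> (real \<Rightarrow> 'a)) \<Rightarrow> bool"

type_synonym 'a md_map_class = "'a mdspace \<Rightarrow> 'a mdspace \<Rightarrow> ('a \<Rightarrow> 'a) \<Rightarrow> bool"

definition on_path_homs :: "'a space_map_class \<Rightarrow> 'a md_map_class" where
  "on_path_homs K X Y f \<longleftrightarrow> md_map X Y f \<and>
     (\<forall>\<alpha>\<in>states X. \<forall>\<beta>\<in>states X.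
        K (path_hom X \<alpha> \<beta>) (path_hom Y (f \<alpha>) (f \<beta>)) (compose {0..1} f))"

definition bij_on_path_homs :: "'a space_map_class \<Rightarrow> 'a md_map_class" where
  "bij_on_path_homs K X Y f \<longleftrightarrow> on_path_homs K X Y f \<and> bij_betw f (states X) (states Y)"


section \<open>Model structures\<close>

definition md_eq :: "'a mdspace \<Rightarrow> ('a \<Rightarrow> 'a) \<Rightarrow> ('a \<Rightarrow> 'a) \<Rightarrow> bool" where
  "md_eq X f g \<longleftrightarrow> (\<forall>x\<in>topspace (carrier_space X). f x = g x)"

definition lifts_against ::
  "'a mdspace \<Rightarrow> 'a mdspace \<Rightarrow> ('a \<Rightarrow> 'a) \<Rightarrow> 'a mdspace \<Rightarrow> 'a mdspace \<Rightarrow> ('a \<Rightarrow> 'a) \<Rightarrow> bool" where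
  "lifts_against A B i X Y p \<longleftrightarrow>
     (\<forall>u v. md_map A X u \<longrightarrow> md_map B Y v \<longrightarrow> md_eq A (p \<circ> u) (v \<circ> i) \<longrightarrow>
        (\<exists>h. md_map B X h \<and> md_eq A (h \<circ> i) u \<and> md_eq B (p \<circ> h) v))"

definition md_retract ::
  "'a mdspace \<Rightarrow> 'a mdspace \<Rightarrow> ('a \<Rightarrow> 'a) \<Rightarrow> 'a mdspace \<Rightarrow> 'a mdspace \<Rightarrow> ('a \<Rightarrow> 'a) \<Rightarrow> bool" where
  "md_retract A B f X Y g \<longleftrightarrow> md_map A B f \<and> md_map X Y g \<and>
     (\<exists>s r s' r'. md_map A X s \<and> md_map X A r \<and> md_map B Y s' \<and> md_map Y B r' \<and>
        md_eq A (r \<circ> s) id \<and> md_eq B (r' \<circ> s') id \<and>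
        md_eq A (g \<circ> s) (s' \<circ> f) \<and> md_eq X (f \<circ> r) (r' \<circ> g))"

definition model_structure ::
  "'a md_map_class \<Rightarrow> 'a md_map_class \<Rightarrow> 'a md_map_class \<Rightarrow> bool" where
  "model_structure Cof W Fib \<longleftrightarrow>
     (\<forall>K\<in>{Cof, W, Fib}. \<forall>X Y f. K X Y f \<longrightarrow> md_map X Y f) \<and>
     (\<forall>K\<in>{Cof, W, Fib}. \<forall>A B f X Y g. K X Y g \<longrightarrow> md_retract A B f X Y g \<longrightarrow> K A B f) \<and>
     (\<forall>X Y Z f g. md_map X Y f \<longrightarrow> md_map Y Z g \<longrightarrow>
        (W X Y f \<and> W Y Z g \<longrightarrow> W X Z (g \<circ> f)) \<and>
        (W X Y f \<and> W X Z (g \<circ> f) \<longrightarrow> W Y Z g) \<and>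
        (W Y Z g \<and> W X Z (g \<circ> f) \<longrightarrow> W X Y f)) \<and>
     (\<forall>A B i X Y p. Cof A B i \<longrightarrow> Fib X Y p \<longrightarrow> W A B i \<or> W X Y p \<longrightarrow>
        lifts_against A B i X Y p) \<and>
     (\<forall>X Y f. md_map X Y f \<longrightarrow>
        (\<exists>Z i p. Cof X Z i \<and> Fib Z Y p \<and> W Z Y p \<and> md_eq X (p \<circ> i) f) \<and>
        (\<exists>Z i p. Cof X Z i \<and> W X Z i \<and> Fib Z Y p \<and> md_eq X (p \<circ> i) f))"

text \<open>A model structure is determined by its weak equivalences and its fibrations: its cofibrations
  are the maps with the left lifting property with respect to the trivial fibrations, see
  \<open>model_structure_cofibration\<close>.\<close>

definition cofibration :: "'a md_map_class \<Rightarrow> 'a md_map_class \<Rightarrow> 'a md_map_class" where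
  "cofibration W Fib A B i \<longleftrightarrow> md_map A B i \<and>
     (\<forall>X Y p. Fib X Y p \<longrightarrow> W X Y p \<longrightarrow> lifts_against A B i X Y p)"

lemma md_map_id: "multipointed_d_space X \<Longrightarrow> md_map X X id"
  by (auto simp: md_map_def multipointed_d_space_def paths_in_def compose_def extensional_restrict)

lemma model_structure_cofibration:
  assumes M: "model_structure Cof W Fib"
  shows "Cof = cofibration W Fib"
proof (intro ext iffI)
  fix A B i assume i: "Cof A B i"
  have "\<forall>A B i X Y p. Cof A B i \<longrightarrow> Fib X Y p \<longrightarrow> W A B i \<or> W X Y p \<longrightarrow>
      lifts_against A B i X Y p"
    using M[unfolded model_structure_def, THEN conjunct2, THEN conjunct2, THEN conjunct2, THEN conjunct1] .
  moreover have "md_map A B i"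
    using M[unfolded model_structure_def, THEN conjunct1, THEN bspec, of Cof] i by simp
  ultimately show "cofibration W Fib A B i"
    using i unfolding cofibration_def by blast
next
  fix A B i assume i: "cofibration W Fib A B i"
  then have mi: "md_map A B i"
    by (simp add: cofibration_def)
  have "\<forall>X Y f. md_map X Y f \<longrightarrow>
      (\<exists>Z i p. Cof X Z i \<and> Fib Z Y p \<and> W Z Y p \<and> md_eq X (p \<circ> i) f) \<and>
      (\<exists>Z i p. Cof X Z i \<and> W X Z i \<and> Fib Z Y p \<and> md_eq X (p \<circ> i) f)"
    using M[unfolded model_structure_def, THEN conjunct2, THEN conjunct2, THEN conjunct2, THEN conjunct2] .
  then obtain Z j p where j: "Cof A Z j" and p: "Fib Z B p" "W Z B p" and pj: "md_eq A (p \<circ> j) i"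
    using mi by blast
  have maps: "\<forall>K\<in>{Cof, W, Fib}. \<forall>X Y f. K X Y f \<longrightarrow> md_map X Y f"
    using M[unfolded model_structure_def, THEN conjunct1] .
  have retracts: "\<forall>K\<in>{Cof, W, Fib}. \<forall>A B f X Y g. K X Y g \<longrightarrow> md_retract A B f X Y g \<longrightarrow> K A B f"
    using M[unfolded model_structure_def, THEN conjunct2, THEN conjunct1] .
  have mj: "md_map A Z j"
    using maps[THEN bspec, of Cof] j by simp
  have mp: "md_map Z B p"
    using maps[THEN bspec, of Fib] p by simp
  have idA: "md_map A A id" and idB: "md_map B B id"
    using mi md_map_id by (auto simp: md_map_def)
  have "lifts_against A B i Z B p"
    using i p by (simp add: cofibration_def)
  then obtain h where h: "md_map B Z h" "md_eq A (h \<circ> i) j" "md_eq B (p \<circ> h) id"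
    unfolding lifts_against_def using mj idB pj by fastforce
  have "md_retract A B i A Z j"
    unfolding md_retract_def
  proof (intro conjI exI)
    show "md_eq A (j \<circ> id) (h \<circ> i)"
      using h(2) by (simp add: md_eq_def)
    show "md_eq A (i \<circ> id) (p \<circ> j)"
      using pj by (simp add: md_eq_def)
    show "md_eq A (id \<circ> id) id"
      by (simp add: md_eq_def)
  qed (fact mi mj idA h mp)+
  then show "Cof A B i"
    using retracts[THEN bspec, of Cof] j by blast
qed

definition empty_mdspace :: "'a mdspace" where
  "empty_mdspace = \<lparr>carrier_space = trivial_topology, states = {}, exec_paths = {}\<rparr>"

text \<open>All functions represent the unique map out of the initial object \<^const>\<open>empty_mdspace\<close>.\<close>

definition cofibrant :: "'a md_map_class \<Rightarrow> 'a md_map_class \<Rightarrow> 'a mdspace \<Rightarrow> bool" where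
  "cofibrant W Fib X \<longleftrightarrow> cofibration W Fib empty_mdspace X id"

definition q_cofibrant :: "'a mdspace \<Rightarrow> bool" where
  "q_cofibrant = cofibrant (bij_on_path_homs weak_homotopy_equivalence) (on_path_homs q_fibration)"

definition h_cofibrant :: "'a mdspace \<Rightarrow> bool" where
  "h_cofibrant = cofibrant (bij_on_path_homs homotopy_equivalence) (on_path_homs h_fibration)"

definition m_cofibrant :: "'a mdspace \<Rightarrow> bool" where
  "m_cofibrant = cofibrant (bij_on_path_homs weak_homotopy_equivalence) (on_path_homs h_fibration)"

end

(* No execution path can see a point of a space without states: for every X with empty state set,
   the map from the initial object to X is a trivial fibration in each of the three model
   structures. If X were cofibrant, the identity of X would lift along this map, which is
   impossible as soon as X has a point. *)

theory Submission
  imports Defs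
begin

lemma multipointed_d_space_stateless:
  "multipointed_d_space \<lparr>carrier_space = kelley T, states = {}, exec_paths = {}\<rparr>"
  by (simp add: multipointed_d_space_def delta_generated_kelley)

lemma multipointed_d_space_empty: "multipointed_d_space empty_mdspace"
  \<comment> \<open>\<open>kelley\<close> keeps the underlying set, and the empty set carries only
    one topology.\<close>
  using multipointed_d_space_stateless[of trivial_topology]
  by (metis empty_mdspace_def null_topspace_iff_trivial topspace_kelley)

lemma md_map_from_empty: "multipointed_d_space X \<Longrightarrow> md_map empty_mdspace X f"
  using multipointed_d_space_empty by (simp add: md_map_def) (simp add: empty_mdspace_def)

text \<open>The condition involving \<open>K\<close> ranges over pairs of states of the source,
  which has none, so \<open>K\<close> is arbitrary and one argument serves all three model
  structures.\<close>

lemma bij_on_path_homs_from_empty: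
  assumes "multipointed_d_space X" "states X = {}"
  shows "bij_on_path_homs K empty_mdspace X f"
  using md_map_from_empty[OF assms(1)] assms(2)
  by (simp add: bij_on_path_homs_def on_path_homs_def) (simp add: empty_mdspace_def bij_betw_def)

lemma not_cofibrant_stateless:
  assumes X: "multipointed_d_space X" "states X = {}" and ne: "topspace (carrier_space X) \<noteq> {}"
  shows "\<not> cofibrant (bij_on_path_homs K) (on_path_homs L) X"
proof
  assume "cofibrant (bij_on_path_homs K) (on_path_homs L) X"
  moreover have "bij_on_path_homs K empty_mdspace X id" "on_path_homs L empty_mdspace X id"
    \<comment> \<open>The fibration half comes from the instance \<open>K = L\<close>.\<close>
    using bij_on_path_homs_from_empty[OF X] by (auto simp: bij_on_path_homs_def)
  ultimately have "lifts_against empty_mdspace X id empty_mdspace X id"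
    by (simp add: cofibrant_def cofibration_def)
  moreover have "md_map empty_mdspace empty_mdspace id" "md_map X X id"
    "md_eq empty_mdspace (id \<circ> id) (id \<circ> id)"
    by (simp_all add: md_map_id multipointed_d_space_empty X md_eq_def)
  ultimately obtain h where "md_map X empty_mdspace h"
    unfolding lifts_against_def by blast
  then show False
    \<comment> \<open>\<open>h\<close> would send a point of \<open>X\<close> into the empty
      carrier.\<close>
    using ne by (auto simp: md_map_def empty_mdspace_def continuous_map_def Pi_iff simp del: null_topspace_iff_trivial)
qed

theorem proposition6p19:
  shows "\<exists>X :: 'u mdspace.
    multipointed_d_space X \<and> \<not> q_cofibrant X \<and> \<not> h_cofibrant X \<and> \<not> m_cofibrant X"
proof -
  \<comment> \<open>Any nonempty carrier would do: \<open>UNIV\<close> has a point at every type,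
    and \<open>kelley\<close> makes the space \<Delta>-generated.\<close>
  define X :: "'u mdspace" where
    "X = \<lparr>carrier_space = kelley (discrete_topology UNIV), states = {}, exec_paths = {}\<rparr>"
  have X: "multipointed_d_space X" "states X = {}" "topspace (carrier_space X) \<noteq> {}"
    by (simp_all add: X_def multipointed_d_space_stateless)
  show ?thesis
    using X(1) not_cofibrant_stateless[OF X]
    unfolding q_cofibrant_def h_cofibrant_def m_cofibrant_def by blast
qed

end
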